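(* Let $X$ be a complex Banach space, let $\alpha\ge 0$, let $T\in\mathcal B(X)$ be a $(C,\alpha)$-bounded operator, and let $\beta>\alpha$. Then $T$ is $(C,\beta)$-ergodic if and only if $$X=\operatorname{Ker}(I-T)\oplus\overline{\operatorname{Ran}}(I-T).$$
   Context: $\mathcal B(X)$ is the algebra of bounded linear operators on $X$; $\overline{\operatorname{Ran}}(I-T)$ is the norm closure of the range of $I-T$. For $\alpha\in\mathbb R$ the Cesàro numbers are $k^\alpha(0)=1$, $k^\alpha(n)=\frac{\alpha(\alpha+1)\cdots(\alpha+n-1)}{n!}$ for $n\ge1$. For $T\in\mathcal B(X)$, $\alpha\ge0$ and $n\in\mathbb N_0=\{0,1,2,\dots\}$ put $\Delta^{-\alpha}\mathcal T(n)=\sum_{j=0}^n k^\alpha(n-j)T^j$ and $M_T^\alpha(n)=\frac{1}{k^{\alpha+1}(n)}\Delta^{-\alpha}\mathcal T(n)$. The operator $T$ is $(C,\alpha)$-bounded if $\sup_n\|M_T^\alpha(n)\|<\infty$, and $(C,\alpha)$-ergodic if $\lim_{n\to\infty}M_T^\alpha(n)x$ exists in norm for every $x\in X$. The sum is a topological direct sum. *)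

theory Defs
  imports "HOL-Analysis.Analysis"
begin

text \<open>
  Complex normed spaces as real ones whose real scalar multiplication is the restriction of a
  complex one, with the same norm.
\<close>

class complex_normed_vector = real_normed_vector +
  fixes scaleC :: "complex \<Rightarrow> 'a \<Rightarrow> 'a"  (infixr \<open>*\<^sub>C\<close> 75)
  assumes scaleC_add_right: "c *\<^sub>C (x + y) = c *\<^sub>C x + c *\<^sub>C y"
    and scaleC_add_left: "(c + d) *\<^sub>C x = c *\<^sub>C x + d *\<^sub>C x"
    and scaleC_scaleC: "c *\<^sub>C (d *\<^sub>C x) = (c * d) *\<^sub>C x"
    and scaleC_one: "1 *\<^sub>C x = x"
    and scaleR_scaleC: "r *\<^sub>R x = complex_of_real r *\<^sub>C x"
    and norm_scaleC: "norm (c *\<^sub>C x) = cmod c * norm x"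

class complex_banach = complex_normed_vector + banach

instantiation complex :: complex_banach
begin

definition scaleC_complex :: "complex \<Rightarrow> complex \<Rightarrow> complex" where
  "scaleC_complex c x = c * x"

instance
  by standard (simp_all add: scaleC_complex_def algebra_simps norm_mult scaleR_conv_of_real)

end

definition csubspace :: "'a::complex_normed_vector set \<Rightarrow> bool" where
  "csubspace U \<longleftrightarrow> 0 \<in> U \<and> (\<forall>x\<in>U. \<forall>y\<in>U. x + y \<in> U) \<and> (\<forall>c. \<forall>x\<in>U. c *\<^sub>C x \<in> U)"

text \<open>
  Bijectivity of addition \<open>U \<times> V \<rightarrow> X\<close> says that the sum is direct and equal to \<open>X\<close>; continuity
  of its inverse says that the two associated projections are continuous.
\<close>

definition topological_direct_sum :: "'a::complex_normed_vector set \<Rightarrow> 'a set \<Rightarrow> bool" where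
  "topological_direct_sum U V \<longleftrightarrow> csubspace U \<and> csubspace V \<and>
     (\<exists>g. homeomorphism (U \<times> V) UNIV (\<lambda>(u, v). u + v) g)"

text \<open>
  The type \<open>'a \<Rightarrow>\<^sub>L 'a\<close> consists of the real-linear bounded operators; together with the following
  condition it yields the bounded complex-linear ones, with the same operator norm.
\<close>

definition complex_homogeneous :: "('a::complex_normed_vector \<Rightarrow>\<^sub>L 'a) \<Rightarrow> bool" where
  "complex_homogeneous T \<longleftrightarrow> (\<forall>c x. blinfun_apply T (c *\<^sub>C x) = c *\<^sub>C blinfun_apply T x)"

definition cesaro_number :: "real \<Rightarrow> nat \<Rightarrow> real" where
  "cesaro_number \<alpha> n = pochhammer \<alpha> n / fact n"

definition blinfun_power :: "('a::real_normed_vector \<Rightarrow>\<^sub>L 'a) \<Rightarrow> nat \<Rightarrow> 'a \<Rightarrow>\<^sub>L 'a" where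
  "blinfun_power T n = (blinfun_compose T ^^ n) id_blinfun"

definition cesaro_sum :: "real \<Rightarrow> ('a::real_normed_vector \<Rightarrow>\<^sub>L 'a) \<Rightarrow> nat \<Rightarrow> 'a \<Rightarrow>\<^sub>L 'a" where
  "cesaro_sum \<alpha> T n = (\<Sum>j=0..n. cesaro_number \<alpha> (n - j) *\<^sub>R blinfun_power T j)"

definition cesaro_mean :: "real \<Rightarrow> ('a::real_normed_vector \<Rightarrow>\<^sub>L 'a) \<Rightarrow> nat \<Rightarrow> 'a \<Rightarrow>\<^sub>L 'a" where
  "cesaro_mean \<alpha> T n = (1 / cesaro_number (\<alpha> + 1) n) *\<^sub>R cesaro_sum \<alpha> T n"

definition cesaro_bounded :: "real \<Rightarrow> ('a::real_normed_vector \<Rightarrow>\<^sub>L 'a) \<Rightarrow> bool" where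
  "cesaro_bounded \<alpha> T \<longleftrightarrow> bdd_above (range (\<lambda>n. norm (cesaro_mean \<alpha> T n)))"

definition cesaro_ergodic :: "real \<Rightarrow> ('a::real_normed_vector \<Rightarrow>\<^sub>L 'a) \<Rightarrow> bool" where
  "cesaro_ergodic \<alpha> T \<longleftrightarrow> (\<forall>x. convergent (\<lambda>n. blinfun_apply (cesaro_mean \<alpha> T n) x))"

end

theory Submission
  imports Defs
begin

text \<open>
  Write \<open>S\<^bsup>a\<^esup>(n)\<close> for the Cesaro sum of order \<open>a\<close> and \<open>M\<^bsup>a\<^esup>(n)\<close> for the mean. The convolution law
  \<open>k\<^bsup>a\<^esup> * k\<^bsup>b\<^esup> = k\<^bsup>a+b\<^esup>\<close> gives \<open>S\<^bsup>b\<^esup> = k\<^bsup>b-a\<^esup> * S\<^bsup>a\<^esup>\<close>. As \<open>k\<^bsup>b-a\<^esup> \<ge> 0\<close> for \<open>b \<ge> a\<close>, boundedness of the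
  means passes from \<open>a\<close> to \<open>b\<close>. So we may assume that \<open>\<beta> - 1 < \<alpha> < \<beta>\<close>; then the only positive term
  of \<open>k\<^bsup>\<beta>-1-\<alpha>\<^esup>\<close> is the one of index \<open>0\<close>, hence \<open>\<parallel>S\<^bsup>\<beta>-1\<^esup>(n)\<parallel> = O(k\<^bsup>\<alpha>+1\<^esup>(n)) = o(k\<^bsup>\<beta>+1\<^esup>(n))\<close>. The
  identity \<open>S\<^bsup>\<beta>\<^esup>(n) (I - T) = k\<^bsup>\<beta>\<^esup>(n+1) I - S\<^bsup>\<beta>-1\<^esup>(n+1)\<close> therefore shows that the means of order \<open>\<beta>\<close>
  tend to \<open>0\<close> on the closure of the range of \<open>I - T\<close>. They are the identity on the kernel, and
  \<open>x - M\<^bsup>\<beta>\<^esup>(n) x\<close> lies in the range of \<open>I - T\<close>, so the limit operator, if it exists, is the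
  projection onto the kernel along the closed range.
\<close>

section \<open>Cesaro numbers: signs, recursions, convolution, growth\<close>

lemma cesaro_number_0 [simp]: "cesaro_number a 0 = 1"
  by (simp add: cesaro_number_def)

text \<open>These are the coefficients of (1 - z)^(-a); in this form Vandermonde's identity applies
  to them.\<close>

lemma cesaro_number_gbinomial: "cesaro_number a n = (-1) ^ n * ((- a) gchoose n)"
  by (simp add: cesaro_number_def gbinomial_pochhammer mult.assoc [symmetric]
      power_mult_distrib [symmetric])

lemma cesaro_number_nonneg: "0 \<le> a \<Longrightarrow> 0 \<le> cesaro_number a n"
  by (simp add: cesaro_number_def pochhammer_prod prod_nonneg)

lemma cesaro_number_pos: "0 < a \<Longrightarrow> 0 < cesaro_number a n"
  by (simp add: cesaro_number_def pochhammer_pos)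

text \<open>The Pochhammer product starts with the factor a \<le> 0, and all later factors are at
  least a + 1 \<ge> 0.\<close>

lemma cesaro_number_nonpos:
  assumes "-1 \<le> a" "a \<le> 0" "0 < n"
  shows "cesaro_number a n \<le> 0"
proof -
  obtain m where n: "n = Suc m"
    using assms(3) gr0_implies_Suc by blast
  have "0 \<le> pochhammer (a + 1) m"
    using assms(1) by (simp add: pochhammer_prod prod_nonneg)
  then show ?thesis
    using assms(2) unfolding cesaro_number_def n pochhammer_rec
    by (intro divide_nonpos_pos mult_nonpos_nonneg) auto
qed

lemma cesaro_number_1 [simp]: "cesaro_number 1 n = 1"
  by (simp add: cesaro_number_def pochhammer_fact [symmetric])

lemma cesaro_number_Suc_shift:
  "cesaro_number a (Suc n) = a / real (Suc n) * cesaro_number (a + 1) n"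
  by (simp add: cesaro_number_def pochhammer_rec)

lemma cesaro_number_Suc:
  "cesaro_number a (Suc n) = (a + real n) / real (Suc n) * cesaro_number a n"
  by (simp add: cesaro_number_def pochhammer_Suc)

lemma cesaro_number_diff:
  "cesaro_number (a - 1) (Suc n) = cesaro_number a (Suc n) - cesaro_number a n"
  unfolding cesaro_number_Suc_shift [of "a - 1"] cesaro_number_Suc [of a]
  by (simp add: field_simps)

lemma cesaro_number_convolution:
  "(\<Sum>i=0..n. cesaro_number a (n - i) * cesaro_number b i) = cesaro_number (a + b) n"
proof -
  have "(\<Sum>i=0..n. cesaro_number a (n - i) * cesaro_number b i)
      = (\<Sum>i=0..n. (-1) ^ n * (((- b) gchoose i) * ((- a) gchoose (n - i))))"
  proof (rule sum.cong [OF refl])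
    fix i assume "i \<in> {0..n}"
    then have "(-1) ^ (n - i) * (-1) ^ i = ((-1) ^ n :: real)"
      by (simp add: power_add [symmetric])
    then show "cesaro_number a (n - i) * cesaro_number b i
        = (-1) ^ n * (((- b) gchoose i) * ((- a) gchoose (n - i)))"
      unfolding cesaro_number_gbinomial by (metis mult.commute mult.left_commute)
  qed
  also have "\<dots> = (-1) ^ n * ((- b + - a) gchoose n)"
    by (simp only: sum_distrib_left [symmetric] gbinomial_Vandermonde [symmetric] atLeast0AtMost)
  finally show ?thesis
    by (simp add: cesaro_number_gbinomial add.commute)
qed

text \<open>By the product formula for Gamma, \<open>cesaro_number a n\<close> is asymptotic to
  n^(a-1) / Gamma(a), so the ratio decays like n^(a-b).\<close>

lemma cesaro_number_ratio_tendsto_0: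
  assumes "0 < a" "a < b"
  shows "(\<lambda>n. cesaro_number a n / cesaro_number b n) \<longlonglongrightarrow> 0"
proof -
  have "(\<lambda>n. Gamma_series' b n / Gamma_series' a n * real n powr (a - b))
      \<longlonglongrightarrow> Gamma b / Gamma a * 0"
  proof (intro tendsto_intros Gamma_series'_LIMSEQ)
    show "Gamma a \<noteq> 0"
      using assms Gamma_real_pos [of a] by linarith
    show "(\<lambda>n. real n powr (a - b)) \<longlonglongrightarrow> 0"
      using assms by (intro tendsto_neg_powr filterlim_real_sequentially) auto
  qed
  moreover have "\<forall>\<^sub>F n in sequentially.
      Gamma_series' b n / Gamma_series' a n * real n powr (a - b)
        = cesaro_number a n / cesaro_number b n"
  \<comment> \<open>At n = 0 the equation fails: \<open>0 powr (a - b)\<close> is 0, while the ratio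
    is 1.\<close>
  proof (rule eventually_sequentiallyI [of 1])
    fix n :: nat assume "1 \<le> n"
    moreover have "pochhammer a n > 0" "pochhammer b n > 0"
      using assms by (auto intro: pochhammer_pos)
    ultimately show "Gamma_series' b n / Gamma_series' a n * real n powr (a - b)
        = cesaro_number a n / cesaro_number b n"
      by (simp add: Gamma_series'_def cesaro_number_def powr_def left_diff_distrib exp_diff)
  qed
  ultimately show ?thesis
    by (simp add: filterlim_cong)
qed

text \<open>For this d the absolute values are 2 * delta_0 - k^d, because k^d(0) = 1 and the other
  terms are nonpositive. Convolution with k^a gives 2 k^a - k^(d+a), and k^(d+a) \<ge> 0.\<close>

lemma sum_abs_cesaro_number_le:
  assumes "-1 \<le> d" "d \<le> 0" "0 \<le> a + d"
  shows "(\<Sum>i=0..n. \<bar>cesaro_number d (n - i)\<bar> * cesaro_number a i) \<le> 2 * cesaro_number a n"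
proof -
  have abs_eq: "\<bar>cesaro_number d m\<bar> = (if m = 0 then 2 else 0) - cesaro_number d m" for m
    using cesaro_number_nonpos [of d m] assms by auto
  have "(\<Sum>i=0..n. \<bar>cesaro_number d (n - i)\<bar> * cesaro_number a i)
      = (\<Sum>i=0..n. (if i = n then 2 * cesaro_number a i else 0)
          - cesaro_number d (n - i) * cesaro_number a i)"
    unfolding abs_eq by (intro sum.cong) (auto simp: algebra_simps)
  also have "\<dots> = 2 * cesaro_number a n - cesaro_number (d + a) n"
    by (simp add: sum_subtractf cesaro_number_convolution)
  finally show ?thesis
    using cesaro_number_nonneg [of "d + a" n] assms by simp
qed

section \<open>Algebra of Cesaro sums and means\<close>

lemma blinfun_power_0 [simp]: "blinfun_apply (blinfun_power T 0) x = x"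
  by (simp add: blinfun_power_def)

lemma blinfun_power_Suc [simp]:
  "blinfun_apply (blinfun_power T (Suc n)) x = blinfun_apply T (blinfun_apply (blinfun_power T n) x)"
  by (simp add: blinfun_power_def)

lemma blinfun_power_Suc2:
  "blinfun_apply (blinfun_power T (Suc n)) x = blinfun_apply (blinfun_power T n) (blinfun_apply T x)"
  by (induction n) simp_all

lemma cesaro_sum_apply:
  "blinfun_apply (cesaro_sum a T n) x
    = (\<Sum>j=0..n. cesaro_number a (n - j) *\<^sub>R blinfun_apply (blinfun_power T j) x)"
  by (simp add: cesaro_sum_def blinfun.sum_left blinfun.scaleR_left)

lemma cesaro_mean_apply:
  "blinfun_apply (cesaro_mean a T n) x
    = (1 / cesaro_number (a + 1) n) *\<^sub>R blinfun_apply (cesaro_sum a T n) x"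
  by (simp add: cesaro_mean_def blinfun.scaleR_left)

text \<open>Exchanging the sums over the triangle j \<le> i \<le> n leaves, as coefficient of T^j, a
  convolution of Cesaro numbers shifted by j.\<close>

lemma cesaro_sum_convolution:
  "cesaro_sum (a + b) T n = (\<Sum>i=0..n. cesaro_number a (n - i) *\<^sub>R cesaro_sum b T i)"
proof -
  have "(\<Sum>i=0..n. cesaro_number a (n - i) *\<^sub>R cesaro_sum b T i)
      = (\<Sum>i\<in>{0..n}. \<Sum>j\<in>{j \<in> {0..n}. j \<le> i}.
          (cesaro_number a (n - i) * cesaro_number b (i - j)) *\<^sub>R blinfun_power T j)"
    unfolding cesaro_sum_def scaleR_sum_right scaleR_scaleR
    by (intro sum.cong) auto
  also have "\<dots> = (\<Sum>j\<in>{0..n}. \<Sum>i\<in>{i \<in> {0..n}. j \<le> i}.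
          (cesaro_number a (n - i) * cesaro_number b (i - j)) *\<^sub>R blinfun_power T j)"
    by (rule sum.swap_restrict) auto
  also have "\<dots> = (\<Sum>j=0..n. cesaro_number (a + b) (n - j) *\<^sub>R blinfun_power T j)"
  proof (rule sum.cong [OF refl])
    fix j assume j: "j \<in> {0..n}"
    have "(\<Sum>i\<in>{i \<in> {0..n}. j \<le> i}. cesaro_number a (n - i) * cesaro_number b (i - j))
        = (\<Sum>i=0..n-j. cesaro_number a (n - j - i) * cesaro_number b i)"
      using j by (intro sum.reindex_bij_witness [of _ "\<lambda>i. i + j" "\<lambda>i. i - j"]) auto
    then show "(\<Sum>i\<in>{i \<in> {0..n}. j \<le> i}.
          (cesaro_number a (n - i) * cesaro_number b (i - j)) *\<^sub>R blinfun_power T j)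
        = cesaro_number (a + b) (n - j) *\<^sub>R blinfun_power T j"
      by (simp only: scaleR_sum_left [symmetric] cesaro_number_convolution)
  qed
  finally show ?thesis
    by (simp add: cesaro_sum_def)
qed

lemma cesaro_sum_diff:
  "cesaro_sum (a - 1) T (Suc n) = cesaro_sum a T (Suc n) - cesaro_sum a T n"
proof -
  \<comment> \<open>The term j = n + 1 has coefficient k(0) = 1 for both orders, so it suffices to
    compare the terms up to n.\<close>
  have "(\<Sum>j=0..n. cesaro_number (a - 1) (Suc n - j) *\<^sub>R blinfun_power T j)
      = (\<Sum>j=0..n. cesaro_number a (Suc n - j) *\<^sub>R blinfun_power T j)
        - (\<Sum>j=0..n. cesaro_number a (n - j) *\<^sub>R blinfun_power T j)"
    by (simp add: sum_subtractf [symmetric] Suc_diff_le cesaro_number_diff scaleR_diff_left)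
  then show ?thesis
    by (simp add: cesaro_sum_def)
qed

lemma cesaro_sum_Suc_apply:
  "blinfun_apply (cesaro_sum a T (Suc n)) x
    = cesaro_number a (Suc n) *\<^sub>R x + blinfun_apply (cesaro_sum a T n) (blinfun_apply T x)"
  unfolding cesaro_sum_apply blinfun_power_Suc2 [symmetric]
  by (subst sum.atLeast0_atMost_Suc_shift) simp

text \<open>Two expressions for the sum at n + 1 are combined: the difference in n lowers the order
  by one, and splitting off the term j = 0 leaves the sum at n applied to T x.\<close>

lemma cesaro_sum_apply_minus:
  "blinfun_apply (cesaro_sum a T n) (x - blinfun_apply T x)
    = cesaro_number a (Suc n) *\<^sub>R x - blinfun_apply (cesaro_sum (a - 1) T (Suc n)) x"
  unfolding cesaro_sum_diff blinfun.diff_left blinfun.diff_right cesaro_sum_Suc_apply by simp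

lemma cesaro_mean_commute:
  "blinfun_apply (cesaro_mean a T n) (blinfun_apply T x)
    = blinfun_apply T (blinfun_apply (cesaro_mean a T n) x)"
  unfolding cesaro_mean_apply cesaro_sum_apply blinfun_power_Suc2 [symmetric]
  by (simp add: blinfun.scaleR_right blinfun.sum_right)

text \<open>Convolution with k^1, which is constantly 1. Thus the normalising factor of a mean makes
  its coefficients sum to 1.\<close>

lemma sum_cesaro_number: "(\<Sum>j=0..n. cesaro_number a (n - j)) = cesaro_number (a + 1) n"
  using cesaro_number_convolution [of a n 1] by simp

lemma cesaro_mean_fixed:
  assumes "0 < a + 1" "blinfun_apply T x = x"
  shows "blinfun_apply (cesaro_mean a T n) x = x"
proof -
  have "blinfun_apply (blinfun_power T j) x = x" for j
    by (induction j) (simp_all add: assms)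
  then show ?thesis
    using cesaro_number_pos [OF assms(1), of n]
    by (simp add: cesaro_mean_apply cesaro_sum_apply scaleR_sum_left [symmetric] sum_cesaro_number)
qed

text \<open>As the coefficients of the mean sum to 1, the difference is a linear combination of the
  vectors x - T^j x, and each of these telescopes into elements of the range.\<close>

lemma minus_cesaro_mean_in_range:
  assumes "0 < a + 1"
  shows "x - blinfun_apply (cesaro_mean a T n) x \<in> range (blinfun_apply (id_blinfun - T))"
    (is "_ \<in> ?R")
proof -
  have sub: "subspace ?R"
    by (intro linear_subspace_image bounded_linear.linear blinfun.bounded_linear_right) simp
  have power: "x - blinfun_apply (blinfun_power T j) x \<in> ?R" for j
  proof (induction j)
    case 0
    then show ?case using sub by (simp add: subspace_0)
  next
    case (Suc j)
    let ?y = "blinfun_apply (blinfun_power T j) x"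
    have "?y - blinfun_apply T ?y \<in> ?R"
      by (rule image_eqI [of _ _ ?y]) (simp_all add: blinfun.diff_left)
    from subspace_add [OF sub Suc this] show ?case by simp
  qed
  have "x - blinfun_apply (cesaro_mean a T n) x
      = (1 / cesaro_number (a + 1) n) *\<^sub>R
        (\<Sum>j=0..n. cesaro_number a (n - j) *\<^sub>R (x - blinfun_apply (blinfun_power T j) x))"
    using cesaro_number_pos [OF assms, of n]
    by (simp add: cesaro_mean_apply cesaro_sum_apply scaleR_diff_right sum_subtractf
        scaleR_sum_left [symmetric] sum_cesaro_number)
  then show ?thesis
    by (simp add: sub power subspace_scale subspace_sum)
qed

section \<open>Norm estimates and convergence to zero on the closed range\<close>

lemma cesaro_bounded_sum_bound:
  assumes "0 \<le> a" "cesaro_bounded a T"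
  obtains C where "0 \<le> C" "\<And>n. norm (cesaro_sum a T n) \<le> C * cesaro_number (a + 1) n"
proof -
  obtain C where C: "\<And>n. norm (cesaro_mean a T n) \<le> C"
    using assms(2) by (auto simp: cesaro_bounded_def bdd_above_def)
  have "norm (cesaro_sum a T n) \<le> C * cesaro_number (a + 1) n" for n
    using C [of n] cesaro_number_pos [of "a + 1" n] assms(1)
    by (simp add: cesaro_mean_def field_simps)
  moreover have "0 \<le> C"
    using C [of 0] norm_ge_zero order_trans by blast
  ultimately show ?thesis
    using that by blast
qed

text \<open>The absolute values allow negative d, so one estimate serves both for raising the order
  and for lowering it.\<close>

lemma norm_cesaro_sum_add_le:
  assumes "\<And>n. norm (cesaro_sum a T n) \<le> C * cesaro_number (a + 1) n"
  shows "norm (cesaro_sum (d + a) T n)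
    \<le> C * (\<Sum>i=0..n. \<bar>cesaro_number d (n - i)\<bar> * cesaro_number (a + 1) i)"
proof -
  have "norm (cesaro_sum (d + a) T n)
      \<le> (\<Sum>i=0..n. \<bar>cesaro_number d (n - i)\<bar> * norm (cesaro_sum a T i))"
    unfolding cesaro_sum_convolution by (rule sum_norm_le) simp
  also have "\<dots> \<le> (\<Sum>i=0..n. \<bar>cesaro_number d (n - i)\<bar> * (C * cesaro_number (a + 1) i))"
    by (intro sum_mono mult_left_mono assms) simp
  finally show ?thesis
    by (simp add: sum_distrib_left mult_ac)
qed

text \<open>For b - a \<ge> 0 the convolution coefficients are nonnegative and add up exactly to the
  normalising factor of order b, so the constant C is inherited.\<close>

lemma cesaro_bounded_mono:
  assumes "0 \<le> a" "a \<le> b" "cesaro_bounded a T"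
  shows "cesaro_bounded b T"
proof -
  obtain C where C: "\<And>n. norm (cesaro_sum a T n) \<le> C * cesaro_number (a + 1) n"
    using cesaro_bounded_sum_bound assms by metis
  have "norm (cesaro_mean b T n) \<le> C" for n
  proof -
    have "norm (cesaro_sum b T n)
        \<le> C * (\<Sum>i=0..n. \<bar>cesaro_number (b - a) (n - i)\<bar> * cesaro_number (a + 1) i)"
      using norm_cesaro_sum_add_le [OF C, of "b - a" n] by simp
    also have "\<dots> = C * cesaro_number (b + 1) n"
      using cesaro_number_convolution [of "b - a" n "a + 1"] assms
      by (simp add: cesaro_number_nonneg)
    finally show ?thesis
      using cesaro_number_pos [of "b + 1" n] assms by (simp add: cesaro_mean_def field_simps)
  qed
  then show ?thesis
    by (auto simp: cesaro_bounded_def bdd_above_def)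
qed

lemma cesaro_mean_range_tendsto_0:
  assumes "0 \<le> a" "cesaro_bounded a T" "a < b"
  shows "(\<lambda>n. blinfun_apply (cesaro_mean b T n) (x - blinfun_apply T x)) \<longlonglongrightarrow> 0"
proof -
  \<comment> \<open>An order between a and b at distance less than 1 from b; any number strictly
    between 0 and 1 could replace 1/2.\<close>
  define c where "c = max a (b - 1 / 2)"
  have c: "0 \<le> c" "a \<le> c" "c < b" "b - 1 < c"
    using assms by (auto simp: c_def)
  then have "cesaro_bounded c T"
    using cesaro_bounded_mono assms by blast
  then obtain C where C: "0 \<le> C" "\<And>n. norm (cesaro_sum c T n) \<le> C * cesaro_number (c + 1) n"
    using cesaro_bounded_sum_bound c by metis
  have sum_bound: "norm (cesaro_sum (b - 1) T n) \<le> C * (2 * cesaro_number (c + 1) n)" for n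
  proof -
    have "norm (cesaro_sum (b - 1) T n)
        \<le> C * (\<Sum>i=0..n. \<bar>cesaro_number (b - 1 - c) (n - i)\<bar> * cesaro_number (c + 1) i)"
      using norm_cesaro_sum_add_le [OF C(2), of "b - 1 - c" n] by simp
    \<comment> \<open>Here d = b - 1 - c lies between -1 and 0, and d + (c + 1) = b \<ge> 0.\<close>
    also have "\<dots> \<le> C * (2 * cesaro_number (c + 1) n)"
      using c C(1) by (intro mult_left_mono sum_abs_cesaro_number_le) auto
    finally show ?thesis .
  qed
  \<comment> \<open>The first summand comes from k^b(n+1) / k^(b+1)(n) = b / (n+1). In the second,
    the factor (b+1+n) / (n+1) moves the denominator from index n to n + 1, so that the ratio limit
    applies.\<close>
  define e where "e n = b / real (Suc n) * norm x
      + 2 * C * ((b + 1 + real n) / real (Suc n))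
          * (cesaro_number (c + 1) (Suc n) / cesaro_number (b + 1) (Suc n)) * norm x" for n
  have "norm (blinfun_apply (cesaro_mean b T n) (x - blinfun_apply T x)) \<le> e n" for n
  proof -
    let ?k = "cesaro_number (b + 1) n"
    have k: "0 < ?k"
      using c by (intro cesaro_number_pos) simp
    have "norm (blinfun_apply (cesaro_sum b T n) (x - blinfun_apply T x))
        \<le> \<bar>cesaro_number b (Suc n)\<bar> * norm x
          + norm (blinfun_apply (cesaro_sum (b - 1) T (Suc n)) x)"
      unfolding cesaro_sum_apply_minus by (rule order_trans [OF norm_triangle_ineq4]) simp
    also have "\<dots> \<le> cesaro_number b (Suc n) * norm x
        + C * (2 * cesaro_number (c + 1) (Suc n)) * norm x"
    proof (rule add_mono)
      show "\<bar>cesaro_number b (Suc n)\<bar> * norm x \<le> cesaro_number b (Suc n) * norm x"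
        using c cesaro_number_nonneg [of b "Suc n"] by simp
      show "norm (blinfun_apply (cesaro_sum (b - 1) T (Suc n)) x)
          \<le> C * (2 * cesaro_number (c + 1) (Suc n)) * norm x"
        by (rule order_trans [OF norm_blinfun mult_right_mono [OF sum_bound norm_ge_zero]])
    qed
    also have "\<dots> = ?k * e n"
    proof -
      let ?q = "(b + 1 + real n) / real (Suc n)" and ?l = "cesaro_number (b + 1) (Suc n)"
      have l: "?l \<noteq> 0" "?l = ?q * ?k"
        using c cesaro_number_pos [of "b + 1" "Suc n"] cesaro_number_Suc [of "b + 1" n] by auto
      have distrib: "k * (s * N + 2 * C * q * r * N) = s * k * N + 2 * C * (q * k) * r * N"
        for k s q r N :: real
        by (simp add: algebra_simps)
      have "?k * e n = cesaro_number b (Suc n) * norm x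
          + 2 * C * (?q * ?k) * (cesaro_number (c + 1) (Suc n) / ?l) * norm x"
        unfolding e_def cesaro_number_Suc_shift [of b] by (rule distrib)
      then show ?thesis
        unfolding l(2) [symmetric] using l(1) by simp
    qed
    finally show ?thesis
      using k by (simp add: cesaro_mean_apply pos_divide_le_eq mult.commute)
  qed
  moreover have "e \<longlonglongrightarrow> 0"
  proof -
    have "(\<lambda>n. b / real (Suc n)) \<longlonglongrightarrow> 0"
      using LIMSEQ_Suc [OF lim_const_over_n [of b]] by simp
    moreover have "(\<lambda>n. (b + 1 + real n) / real (Suc n)) \<longlonglongrightarrow> 1"
    proof -
      have "(\<lambda>n. 1 + b / real (Suc n)) \<longlonglongrightarrow> 1 + 0"
        by (intro tendsto_add tendsto_const calculation)
      moreover have "1 + b / real (Suc n) = (b + 1 + real n) / real (Suc n)" for n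
        by (simp add: divide_simps)
      ultimately show ?thesis
        by simp
    qed
    moreover have "(\<lambda>n. cesaro_number (c + 1) (Suc n) / cesaro_number (b + 1) (Suc n)) \<longlonglongrightarrow> 0"
      using c by (intro LIMSEQ_Suc cesaro_number_ratio_tendsto_0) auto
    ultimately have "e \<longlonglongrightarrow> 0 * norm x + 2 * C * 1 * 0 * norm x"
      unfolding e_def [abs_def] by (intro tendsto_add tendsto_mult tendsto_const)
    then show ?thesis by simp
  qed
  ultimately show ?thesis
    by (rule Lim_null_comparison [OF always_eventually, OF allI])
qed

text \<open>Uniform boundedness: x is approximated by y in S, the error is at most C times the
  distance for every n, and the values at y tend to 0.\<close>

lemma tendsto_0_closure:
  fixes M :: "nat \<Rightarrow> 'a::real_normed_vector \<Rightarrow>\<^sub>L 'b::real_normed_vector"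
  assumes bound: "\<And>n. norm (M n) \<le> C"
    and lim: "\<And>y. y \<in> S \<Longrightarrow> (\<lambda>n. blinfun_apply (M n) y) \<longlonglongrightarrow> 0"
    and x: "x \<in> closure S"
  shows "(\<lambda>n. blinfun_apply (M n) x) \<longlonglongrightarrow> 0"
proof (rule tendstoI)
  fix e :: real assume e: "0 < e"
  have C: "0 \<le> C"
    using bound [of 0] norm_ge_zero order_trans by blast
  \<comment> \<open>C + 1 keeps the denominator positive when C = 0.\<close>
  have "0 < e / (2 * (C + 1))"
    using e C by simp
  then obtain y where y: "y \<in> S" "dist y x < e / (2 * (C + 1))"
    using x closure_approachable by blast
  have small: "norm (blinfun_apply (M n) (x - y)) < e / 2" for n
  proof -
    have "norm (blinfun_apply (M n) (x - y)) \<le> norm (M n) * norm (x - y)"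
      by (rule norm_blinfun)
    also have "\<dots> \<le> (C + 1) * norm (x - y)"
      using bound [of n] by (intro mult_right_mono) auto
    also have "\<dots> < e / 2"
      using y(2) C by (simp add: dist_norm norm_minus_commute field_simps)
    finally show ?thesis .
  qed
  have "\<forall>\<^sub>F n in sequentially. dist (blinfun_apply (M n) y) 0 < e / 2"
    using lim [OF y(1)] e by (intro tendstoD) auto
  then show "\<forall>\<^sub>F n in sequentially. dist (blinfun_apply (M n) x) 0 < e"
  proof eventually_elim
    case (elim n)
    have "norm (blinfun_apply (M n) x)
        \<le> norm (blinfun_apply (M n) (x - y)) + norm (blinfun_apply (M n) y)"
      using norm_triangle_ineq [of "blinfun_apply (M n) (x - y)" "blinfun_apply (M n) y"]
      by (simp add: blinfun.diff_right)
    then show ?case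
      using elim small [of n] by simp
  qed
qed

section \<open>Complex subspaces: kernel, range, closure\<close>

lemma csubspace_ker:
  "complex_homogeneous A \<Longrightarrow> csubspace {x. blinfun_apply A x = 0}"
  by (auto simp: csubspace_def complex_homogeneous_def blinfun.add_right blinfun.zero_right)
    (metis norm_eq_zero norm_scaleC mult_zero_right)

lemma csubspace_range:
  assumes "complex_homogeneous A"
  shows "csubspace (range (blinfun_apply A))"
  unfolding csubspace_def
proof (intro conjI ballI allI)
  show "0 \<in> range (blinfun_apply A)"
    by (metis blinfun.zero_right rangeI)
  show "x + y \<in> range (blinfun_apply A)"
    if "x \<in> range (blinfun_apply A)" "y \<in> range (blinfun_apply A)" for x y
    using that by (auto simp: blinfun.add_right [symmetric])
  show "c *\<^sub>C x \<in> range (blinfun_apply A)" if "x \<in> range (blinfun_apply A)" for c x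
    using that assms by (auto simp: complex_homogeneous_def) (metis rangeI)
qed

lemma scaleC_diff_right: "c *\<^sub>C (x - y) = c *\<^sub>C x - c *\<^sub>C (y::'a::complex_normed_vector)"
  using scaleC_add_right [of c "x - y" y] by (simp add: eq_diff_eq)

lemma bounded_linear_scaleC:
  "bounded_linear (\<lambda>x::'a::complex_normed_vector. c *\<^sub>C x)"
  by (rule bounded_linear_intro [of _ "cmod c"])
    (simp_all add: scaleC_add_right scaleR_scaleC scaleC_scaleC norm_scaleC mult.commute)

lemma csubspace_closure:
  assumes "csubspace U"
  shows "csubspace (closure U)"
  unfolding csubspace_def
proof (intro conjI ballI allI)
  show "0 \<in> closure U"
    using assms closure_subset by (auto simp: csubspace_def)
  fix x assume x: "x \<in> closure U"
  then obtain f where f: "\<And>n. f n \<in> U" "f \<longlonglongrightarrow> x"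
    by (auto simp: closure_sequential)
  show "x + y \<in> closure U" if "y \<in> closure U" for y
  proof -
    obtain g where g: "\<And>n. g n \<in> U" "g \<longlonglongrightarrow> y"
      using \<open>y \<in> closure U\<close> by (auto simp: closure_sequential)
    have "(\<lambda>n. f n + g n) \<longlonglongrightarrow> x + y"
      by (intro tendsto_intros f g)
    then show ?thesis
      using assms f g unfolding closure_sequential csubspace_def
      by (intro exI [of _ "\<lambda>n. f n + g n"]) simp
  qed
  show "c *\<^sub>C x \<in> closure U" for c
  proof -
    have "(\<lambda>n. c *\<^sub>C f n) \<longlonglongrightarrow> c *\<^sub>C x"
      by (rule bounded_linear.tendsto [OF bounded_linear_scaleC f(2)])
    then show ?thesis
      using assms f unfolding closure_sequential csubspace_def
      by (intro exI [of _ "\<lambda>n. c *\<^sub>C f n"]) simp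
  qed
qed

section \<open>Convergence of the means and the splitting of the space\<close>

theorem theorem3:
  fixes T :: "'a::complex_banach \<Rightarrow>\<^sub>L 'a" and \<alpha> \<beta> :: real
  assumes "0 \<le> \<alpha>"
    and "complex_homogeneous T"
    and "cesaro_bounded \<alpha> T"
    and "\<alpha> < \<beta>"
  shows "cesaro_ergodic \<beta> T \<longleftrightarrow>
    topological_direct_sum {x. blinfun_apply (id_blinfun - T) x = 0}
      (closure (range (blinfun_apply (id_blinfun - T))))"
    (is "_ \<longleftrightarrow> topological_direct_sum ?K (closure ?R)")
proof -
  let ?M = "\<lambda>n. blinfun_apply (cesaro_mean \<beta> T n)"
  have \<beta>: "0 < \<beta> + 1"
    using assms by simp
  have "cesaro_bounded \<beta> T"
    using cesaro_bounded_mono [of \<alpha> \<beta> T] assms by simp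
  then obtain C where C: "\<And>n. norm (cesaro_mean \<beta> T n) \<le> C"
    by (auto simp: cesaro_bounded_def bdd_above_def)
  have mean_ker: "?M n x = x" if "x \<in> ?K" for n x
    using that cesaro_mean_fixed [OF \<beta>, of T x n] by (simp add: blinfun.diff_left)
  have mean_ran: "(\<lambda>n. ?M n x) \<longlonglongrightarrow> 0" if "x \<in> closure ?R" for x
  proof (rule tendsto_0_closure [OF C _ that])
    fix y assume "y \<in> ?R"
    then show "(\<lambda>n. ?M n y) \<longlonglongrightarrow> 0"
      using cesaro_mean_range_tendsto_0 assms by (auto simp: blinfun.diff_left)
  qed
  show ?thesis
  proof
    assume "topological_direct_sum ?K (closure ?R)"
    then obtain g where g: "homeomorphism (?K \<times> closure ?R) UNIV (\<lambda>(u, v). u + v) g"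
      unfolding topological_direct_sum_def by blast
    show "cesaro_ergodic \<beta> T"
      unfolding cesaro_ergodic_def
    proof
      fix x
      have "x \<in> (\<lambda>(u, v). u + v) ` (?K \<times> closure ?R)"
        using homeomorphism_image1 [OF g] by simp
      then obtain u v where uv: "u \<in> ?K" "v \<in> closure ?R" "x = u + v"
        by (auto simp del: mem_Collect_eq)
      \<comment> \<open>The means fix u and tend to 0 on v, so on x = u + v they converge to
        u.\<close>
      have "(\<lambda>n. u + ?M n v) \<longlonglongrightarrow> u + 0"
        by (intro tendsto_intros mean_ran uv)
      then show "convergent (\<lambda>n. ?M n x)"
        using mean_ker [OF uv(1)] by (auto simp: uv(3) blinfun.add_right convergent_def)
    qed
  next
    assume "cesaro_ergodic \<beta> T"
    then have lim: "(\<lambda>n. ?M n x) \<longlonglongrightarrow> lim (\<lambda>n. ?M n x)" for x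
      by (simp add: cesaro_ergodic_def convergent_LIMSEQ_iff)
    define P where "P x = lim (\<lambda>n. ?M n x)" for x
    have P: "(\<lambda>n. ?M n x) \<longlonglongrightarrow> P x" for x
      using lim by (simp add: P_def)
    have P_eqI: "P x = y" if "(\<lambda>n. ?M n x) \<longlonglongrightarrow> y" for x y
      using LIMSEQ_unique [OF P that] .
    have P_add: "P (x + y) = P x + P y" for x y
      by (rule P_eqI) (simp add: blinfun.add_right tendsto_add P)
    \<comment> \<open>The uniform bound C on the means passes to the pointwise limit. Continuity of
      P is what makes the sum topological.\<close>
    have "bounded_linear P"
    proof (rule bounded_linear_intro [of _ C])
      show "P (x + y) = P x + P y" for x y
        by (rule P_add)
      show "P (r *\<^sub>R x) = r *\<^sub>R P x" for r x
        by (rule P_eqI) (simp add: blinfun.scaleR_right tendsto_scaleR P)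
      show "norm (P x) \<le> norm x * C" for x
      proof (rule Lim_bounded [OF tendsto_norm [OF P]])
        have "norm (?M n x) \<le> norm x * C" for n
          using norm_blinfun [of "cesaro_mean \<beta> T n" x] mult_left_mono [OF C [of n] norm_ge_zero [of x]]
          by (simp add: mult.commute)
        then show "\<forall>n\<ge>0. norm (?M n x) \<le> norm x * C"
          by blast
      qed
    qed
    then have contP: "continuous_on UNIV P"
      by (simp add: linear_continuous_on)
    \<comment> \<open>The limit of the means at x - T x is computed twice: T commutes with the
      means, which gives P x - T (P x), and the means vanish in the limit on the range.\<close>
    have P_ker: "P x \<in> ?K" for x
    proof -
      have "(\<lambda>n. ?M n (x - blinfun_apply T x)) \<longlonglongrightarrow> P x - blinfun_apply T (P x)"
        unfolding blinfun.diff_right cesaro_mean_commute by (intro tendsto_intros P)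
      moreover have "(\<lambda>n. ?M n (x - blinfun_apply T x)) \<longlonglongrightarrow> 0"
        using cesaro_mean_range_tendsto_0 assms by blast
      ultimately have "P x - blinfun_apply T (P x) = 0"
        by (rule LIMSEQ_unique)
      then show ?thesis
        by (simp add: blinfun.diff_left)
    qed
    have P_ran: "x - P x \<in> closure ?R" for x
    proof -
      have "(\<lambda>n. x - ?M n x) \<longlonglongrightarrow> x - P x"
        by (intro tendsto_intros P)
      then show ?thesis
        using minus_cesaro_mean_in_range [OF \<beta>, of x T] unfolding closure_sequential
        by (intro exI [of _ "\<lambda>n. x - ?M n x"]) simp
    qed
    \<comment> \<open>P recovers the kernel component, hence addition is injective and x \<mapsto>
      (P x, x - P x) inverts it.\<close>
    have P_sum: "P (u + v) = u" if "u \<in> ?K" "v \<in> closure ?R" for u v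
    proof -
      have "P u = u"
        by (rule P_eqI) (simp only: mean_ker [OF that(1)] tendsto_const)
      moreover have "P v = 0"
        by (rule P_eqI) (rule mean_ran [OF that(2)])
      ultimately show ?thesis
        by (simp add: P_add)
    qed
    have "homeomorphism (?K \<times> closure ?R) UNIV (\<lambda>(u, v). u + v) (\<lambda>x. (P x, x - P x))"
    proof (rule homeomorphismI)
      show "continuous_on (?K \<times> closure ?R) (\<lambda>(u, v). u + v)"
        unfolding case_prod_unfold by (intro continuous_intros)
      show "continuous_on UNIV (\<lambda>x. (P x, x - P x))"
        by (intro continuous_intros contP)
      show "(\<lambda>x. (P x, x - P x)) ` UNIV \<subseteq> ?K \<times> closure ?R"
        using P_ker P_ran by blast
    qed (auto simp: P_sum)
    moreover have "complex_homogeneous (id_blinfun - T)"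
      using assms(2) by (simp add: complex_homogeneous_def blinfun.diff_left scaleC_diff_right)
    ultimately show "topological_direct_sum ?K (closure ?R)"
      unfolding topological_direct_sum_def
      by (intro conjI exI csubspace_ker csubspace_closure csubspace_range)
  qed
qed

end
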